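(* Let $G$ be a $d$-degenerate simple graph of maximum degree $\Delta$. Then \[\chi_{\mathrm{con}}(G) \leq \left\lceil 2\sqrt{d\left[1 + \log((d+1)\Delta)\right]}\right\rceil .\]
   Context: Graphs have no loops. Let $C$ be a set of colors. A conflict function assigns to each edge $uv$ of $G$ a forbidden ordered pair $f(u,v)=(c_1,c_2)\in C^2$ (with the convention $f(v,u)=(c_2,c_1)$). A (not necessarily proper) coloring $\phi:V(G)\to C$ is a single-conflict coloring with respect to $f$ and $C$ if $(\phi(u),\phi(v))\neq f(u,v)$ for every edge $uv$. The single-conflict chromatic number $\chi_{\mathrm{con}}(G)$ is the minimum integer $k$ such that for every color set $C$ with $|C|=k$ and every conflict function $f$, $G$ has a single-conflict coloring with respect to $f$ and $C$. A graph is $d$-degenerate if every subgraph has a vertex of degree at most $d$. $\log$ denotes the natural logarithm. *)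

theory Defs
  imports Complex_Main "Graph_Theory.Digraph" "Graph_Theory.Digraph_Component"
begin

text \<open>
  A finite simple undirected graph is an instance of the locale \<^locale>\<open>graph\<close>: every edge
  \<open>uv\<close> is represented by exactly two arcs, one in each direction. Hence the degree of a
  vertex in the undirected sense is its \<^const>\<open>out_degree\<close>, and the subgraphs in the
  undirected sense are the symmetric ones among the sub-digraphs.
\<close>

text \<open>The element 0 is inserted only so that the null graph has maximum degree 0.\<close>

definition max_degree :: "('a, 'b) pre_digraph \<Rightarrow> nat" where
  "max_degree G = Max (insert 0 (out_degree G ` verts G))"

definition degenerate :: "nat \<Rightarrow> ('a, 'b) pre_digraph \<Rightarrow> bool" where
  "degenerate d G \<longleftrightarrow>
     (\<forall>H. subgraph H G \<and> symmetric H \<and> verts H \<noteq> {} \<longrightarrow> (\<exists>v \<in> verts H. out_degree H v \<le> d))"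

text \<open>Values of \<open>f\<close> at non-adjacent pairs are irrelevant.\<close>

definition conflict_function ::
    "('a, 'b) pre_digraph \<Rightarrow> 'c set \<Rightarrow> ('a \<Rightarrow> 'a \<Rightarrow> 'c \<times> 'c) \<Rightarrow> bool" where
  "conflict_function G C f \<longleftrightarrow>
     (\<forall>u v. u \<rightarrow>\<^bsub>G\<^esub> v \<longrightarrow> f u v \<in> C \<times> C \<and> f v u = prod.swap (f u v))"

definition single_conflict_coloring ::
    "('a, 'b) pre_digraph \<Rightarrow> 'c set \<Rightarrow> ('a \<Rightarrow> 'a \<Rightarrow> 'c \<times> 'c) \<Rightarrow> ('a \<Rightarrow> 'c) \<Rightarrow> bool" where
  "single_conflict_coloring G C f \<phi> \<longleftrightarrow>
     (\<forall>v \<in> verts G. \<phi> v \<in> C) \<and> (\<forall>u v. u \<rightarrow>\<^bsub>G\<^esub> v \<longrightarrow> (\<phi> u, \<phi> v) \<noteq> f u v)"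

text \<open>
  Color sets range over the finite sets of natural numbers; up to renaming of colors these are
  all finite color sets. The number of colors must be positive: if \<open>G\<close> has an edge, then there
  is no conflict function at all for the empty color set, and \<open>k = 0\<close> would vacuously qualify.
\<close>

definition chi_con :: "('a, 'b) pre_digraph \<Rightarrow> nat" where
  "chi_con G = (LEAST k. 0 < k \<and>
     (\<forall>(C :: nat set) f. finite C \<and> card C = k \<and> conflict_function G C f \<longrightarrow>
        (\<exists>\<phi>. single_conflict_coloring G C f \<phi>)))"

end

theory Submission
  imports Defs "HOL-Probability.Probability"
begin

text \<open>
  Orient the edges of \<open>G\<close> so that every vertex \<open>v\<close> has a set \<open>N v\<close> of at most \<open>d\<close> out-neighbours,
  and let every vertex \<open>v\<close> choose a random set \<open>S v\<close> of colors, each of the \<open>k\<close> colors independently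
  with probability \<open>p = k / (2 d)\<close>. Call a color \<open>c \<in> S v\<close> available if no out-neighbour \<open>w\<close> with
  \<open>f v w = (c, c')\<close> has \<open>c' \<in> S w\<close>; coloring every vertex by an available color is conflict-free.
  If \<open>c\<close> occurs in \<open>n c\<close> of the conflicts of \<open>v\<close> with its out-neighbours, then no color is available
  at \<open>v\<close> with probability
  \<open>(\<Prod>c. 1 - p (1 - p) ^ n c) \<le> exp (- p (\<Sum>c. 1 - p n c)) \<le> exp (- k\<^sup>2 / (4 d))\<close>,
  which is at most \<open>1 / (e (d + 1) \<Delta>)\<close>. This event depends only on the choices in the closed
  out-neighbourhood of \<open>v\<close>, which meets at most \<open>(d + 1) \<Delta>\<close> closed out-neighbourhoods (its own
  included), so the Local Lemma applies. If \<open>k > 2 d\<close>, then \<open>p > 1\<close>, but one can take every \<open>S v\<close>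
  to be the set of all colors.
\<close>

section \<open>The symmetric Lovasz Local Lemma\<close>

text \<open>This is the bound \<open>x\<close> on the probability of \<open>A i\<close> conditioned
  on avoiding all \<open>A j\<close> with \<open>j \<in> S\<close>, multiplied out so that no
  conditioning on a possibly null event occurs. The induction on \<open>card S\<close> separates the
  part of \<open>S\<close> outside \<open>\<Gamma> i\<close>, which is independent of
  \<open>A i\<close>, from the few indices inside.\<close>

lemma (in prob_space) local_lemma_cond:
  fixes A :: "'i \<Rightarrow> 'a set" and \<Gamma> :: "'i \<Rightarrow> 'i set" and x :: real
  assumes "finite I"
    and ev: "\<And>i. i \<in> I \<Longrightarrow> A i \<in> events"
    and indep: "\<And>i J. i \<in> I \<Longrightarrow> J \<subseteq> I - \<Gamma> i \<Longrightarrow>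
      prob (A i \<inter> (space M - (\<Union>j\<in>J. A j))) = prob (A i) * prob (space M - (\<Union>j\<in>J. A j))"
    and self: "\<And>i. i \<in> I \<Longrightarrow> i \<in> \<Gamma> i"
    and fin: "\<And>i. i \<in> I \<Longrightarrow> finite (\<Gamma> i)"
    and deg: "\<And>i. i \<in> I \<Longrightarrow> card (\<Gamma> i) \<le> Suc D"
    and x: "0 \<le> x" "x \<le> 1"
    and small: "\<And>i. i \<in> I \<Longrightarrow> prob (A i) \<le> x * (1 - x) ^ D"
    and "S \<subseteq> I" "i \<in> I" "i \<notin> S"
  shows "prob (A i \<inter> (space M - (\<Union>j\<in>S. A j))) \<le> x * prob (space M - (\<Union>j\<in>S. A j))"
  using \<open>S \<subseteq> I\<close> \<open>i \<in> I\<close> \<open>i \<notin> S\<close>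
proof (induction "card S" arbitrary: S i rule: less_induct)
  case less
  define W where "W J = space M - (\<Union>j\<in>J. A j)" for J
  have finS: "finite S" using less.prems \<open>finite I\<close> finite_subset by blast
  have Wev: "W J \<in> events" if "J \<subseteq> I" for J
    unfolding W_def using that ev \<open>finite I\<close> finite_subset[OF that] by auto
  \<comment> \<open>Avoiding the neighbours one at a time costs a factor of at least
    \<open>1 - x\<close> each. The induction hypothesis applies because each intermediate set misses
    the next index \<open>r\<close> and so is strictly smaller than \<open>S\<close>.\<close>
  have chain: "(1 - x) ^ card R * prob (W (S - \<Gamma> i)) \<le> prob (W (S - \<Gamma> i \<union> R))"
    if "R \<subseteq> S \<inter> \<Gamma> i" for R
  proof -
    have "finite R" using that finS finite_subset by blast
    then show ?thesis using that
    proof (induction R)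
      case empty
      then show ?case by simp
    next
      case (insert r R)
      let ?T = "S - \<Gamma> i \<union> R"
      have T: "?T \<subset> S" "?T \<subseteq> I" "r \<in> I" "r \<notin> ?T"
        using insert less.prems by auto
      have "card ?T < card S" using T finS psubset_card_mono by blast
      then have "prob (A r \<inter> W ?T) \<le> x * prob (W ?T)"
        unfolding W_def using less.hyps T by blast
      moreover have "W (S - \<Gamma> i \<union> insert r R) = W ?T - A r \<inter> W ?T"
        unfolding W_def by auto
      moreover have "prob (W ?T - A r \<inter> W ?T) = prob (W ?T) - prob (A r \<inter> W ?T)"
        using Wev T ev by (intro finite_measure_Diff) auto
      ultimately have "(1 - x) * prob (W ?T) \<le> prob (W (S - \<Gamma> i \<union> insert r R))"
        by (simp add: algebra_simps)
      moreover have "(1 - x) * ((1 - x) ^ card R * prob (W (S - \<Gamma> i))) \<le> (1 - x) * prob (W ?T)"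
        using insert x by (intro mult_left_mono) auto
      ultimately show ?case using insert.hyps by (simp add: mult.assoc)
    qed
  qed
  \<comment> \<open>\<open>\<Gamma> i\<close> contains \<open>i\<close>, but \<open>S\<close> does
    not; this turns \<open>Suc D\<close> into \<open>D\<close>.\<close>
  have "card (S \<inter> \<Gamma> i) \<le> D"
  proof -
    have "S \<inter> \<Gamma> i \<subseteq> \<Gamma> i - {i}" using less.prems by auto
    then have "card (S \<inter> \<Gamma> i) \<le> card (\<Gamma> i - {i})" using fin less.prems by (intro card_mono) auto
    then show ?thesis using deg[of i] self[of i] fin[of i] less.prems by simp
  qed
  then have pow: "(1 - x) ^ D \<le> (1 - x) ^ card (S \<inter> \<Gamma> i)"
    using x by (intro power_decreasing) auto
  \<comment> \<open>Forgetting the events in \<open>\<Gamma> i\<close> only enlarges the set and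
    makes independence applicable; \<open>chain\<close> then pays for restoring them.\<close>
  have "prob (A i \<inter> W S) \<le> prob (A i \<inter> W (S - \<Gamma> i))"
    using Wev[of "S - \<Gamma> i"] ev less.prems by (intro finite_measure_mono) (auto simp: W_def)
  also have "\<dots> = prob (A i) * prob (W (S - \<Gamma> i))"
    unfolding W_def using less.prems by (intro indep) auto
  also have "\<dots> \<le> x * (1 - x) ^ card (S \<inter> \<Gamma> i) * prob (W (S - \<Gamma> i))"
    using small[of i] less.prems mult_left_mono[OF pow x(1)] by (intro mult_right_mono) auto
  also have "\<dots> \<le> x * prob (W (S - \<Gamma> i \<union> S \<inter> \<Gamma> i))"
    using mult_left_mono[OF chain[OF order_refl] x(1)] by (simp add: mult.assoc)
  also have "S - \<Gamma> i \<union> S \<inter> \<Gamma> i = S" by auto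
  finally show ?case by (simp add: W_def)
qed

text \<open>By the conditional bound, each further avoided event keeps at least the fraction
  \<open>1 - x > 0\<close> of the probability, so avoiding all of them has positive
  probability.\<close>

lemma (in prob_space) local_lemma:
  fixes A :: "'i \<Rightarrow> 'a set" and \<Gamma> :: "'i \<Rightarrow> 'i set" and x :: real
  assumes "finite I"
    and ev: "\<And>i. i \<in> I \<Longrightarrow> A i \<in> events"
    and indep: "\<And>i J. i \<in> I \<Longrightarrow> J \<subseteq> I - \<Gamma> i \<Longrightarrow>
      prob (A i \<inter> (space M - (\<Union>j\<in>J. A j))) = prob (A i) * prob (space M - (\<Union>j\<in>J. A j))"
    and self: "\<And>i. i \<in> I \<Longrightarrow> i \<in> \<Gamma> i"
    and fin: "\<And>i. i \<in> I \<Longrightarrow> finite (\<Gamma> i)"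
    and deg: "\<And>i. i \<in> I \<Longrightarrow> card (\<Gamma> i) \<le> Suc D"
    and x: "0 \<le> x" "x < 1"
    and small: "\<And>i. i \<in> I \<Longrightarrow> prob (A i) \<le> x * (1 - x) ^ D"
  shows "\<exists>\<omega>\<in>space M. \<forall>i\<in>I. \<omega> \<notin> A i"
proof -
  define W where "W J = space M - (\<Union>j\<in>J. A j)" for J
  have "0 < prob (W S)" if "finite S" "S \<subseteq> I" for S
    using that
  proof (induction S)
    case empty
    then show ?case by (simp add: W_def prob_space)
  next
    case (insert r S)
    have "prob (A r \<inter> W S) \<le> x * prob (W S)"
      unfolding W_def using insert x \<open>finite I\<close> indep self fin deg small ev
      by (intro local_lemma_cond[where I = I and \<Gamma> = \<Gamma> and D = D]) auto
    moreover have "W (insert r S) = W S - A r \<inter> W S"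
      unfolding W_def by auto
    moreover have "W S \<in> events" unfolding W_def using insert ev by auto
    then have "prob (W S - A r \<inter> W S) = prob (W S) - prob (A r \<inter> W S)"
      using insert ev by (intro finite_measure_Diff) auto
    ultimately have "(1 - x) * prob (W S) \<le> prob (W (insert r S))"
      by (simp add: algebra_simps)
    moreover have "0 < (1 - x) * prob (W S)" using insert x by simp
    ultimately show ?case by linarith
  qed
  from this[OF \<open>finite I\<close> order_refl] have "W I \<noteq> {}" by auto
  then show ?thesis by (auto simp: W_def)
qed

text \<open>For positive \<open>D\<close> this is \<open>(1 + 1/D) ^ D \<le> exp 1\<close>
  inverted.\<close>

lemma inverse_exp_le_power:
  fixes D :: nat
  shows "exp (-1) \<le> (1 - 1 / real (Suc D)) ^ D"
proof (cases "D = 0")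
  case False
  have "1 + 1 / real D \<le> exp (1 / real D)" by (rule exp_ge_add_one_self)
  then have "(1 + 1 / real D) ^ D \<le> exp (1 / real D) ^ D" by (intro power_mono) auto
  also have "\<dots> = exp 1" using False by (simp flip: exp_of_nat_mult)
  finally have le: "(1 + 1 / real D) ^ D \<le> exp 1" .
  have "1 - 1 / real (Suc D) = inverse (1 + 1 / real D)" using False by (simp add: field_simps)
  then have "(1 - 1 / real (Suc D)) ^ D = inverse ((1 + 1 / real D) ^ D)"
    by (simp add: power_inverse)
  then show ?thesis using le False by (simp add: exp_minus le_imp_inverse_le add_pos_nonneg)
qed auto

text \<open>The choice is \<open>x = 1 / K\<close> and \<open>D = K - 1\<close>, since
  \<open>K\<close> also counts the event itself; \<open>2 \<le> K\<close> makes
  \<open>x < 1\<close>.\<close>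

lemma (in prob_space) symmetric_local_lemma:
  fixes A :: "'i \<Rightarrow> 'a set" and \<Gamma> :: "'i \<Rightarrow> 'i set" and K :: nat
  assumes "finite I"
    and ev: "\<And>i. i \<in> I \<Longrightarrow> A i \<in> events"
    and indep: "\<And>i J. i \<in> I \<Longrightarrow> J \<subseteq> I - \<Gamma> i \<Longrightarrow>
      prob (A i \<inter> (space M - (\<Union>j\<in>J. A j))) = prob (A i) * prob (space M - (\<Union>j\<in>J. A j))"
    and self: "\<And>i. i \<in> I \<Longrightarrow> i \<in> \<Gamma> i"
    and fin: "\<And>i. i \<in> I \<Longrightarrow> finite (\<Gamma> i)"
    and deg: "\<And>i. i \<in> I \<Longrightarrow> card (\<Gamma> i) \<le> K"
    and K: "2 \<le> K"
    and small: "\<And>i. i \<in> I \<Longrightarrow> exp 1 * prob (A i) * real K \<le> 1"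
  shows "\<exists>\<omega>\<in>space M. \<forall>i\<in>I. \<omega> \<notin> A i"
proof -
  from K obtain D where D: "K = Suc D" by (cases K) auto
  show ?thesis
  proof (rule local_lemma[where x = "1 / real K" and D = D and \<Gamma> = \<Gamma>])
    fix i assume i: "i \<in> I"
    have "prob (A i) \<le> 1 / real K * exp (-1)"
      using small[OF i] K by (simp add: exp_minus field_simps)
    also have "\<dots> \<le> 1 / real K * (1 - 1 / real K) ^ D"
      unfolding D by (intro mult_left_mono inverse_exp_le_power) auto
    finally show "prob (A i) \<le> 1 / real K * (1 - 1 / real K) ^ D" .
  qed (use assms D in auto)
qed

section \<open>Events depending on disjoint blocks of coordinates\<close>

text \<open>A set-level form of being determined by the coordinates in \<open>X\<close>. On the
  discrete spaces used here it replaces measurability with respect to those coordinates.\<close>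

definition depends_on :: "('i \<Rightarrow> 'b) set \<Rightarrow> 'i set \<Rightarrow> bool" where
  "depends_on E X \<longleftrightarrow> (\<forall>\<omega> \<omega>'. (\<forall>x\<in>X. \<omega> x = \<omega>' x) \<longrightarrow> (\<omega> \<in> E \<longleftrightarrow> \<omega>' \<in> E))"

text \<open>The restrictions of a product-distributed function to disjoint blocks are independent,
  and each \<open>E j\<close> is the preimage of an event under the restriction to
  \<open>K j\<close>.\<close>

lemma prob_Inter_depends_on_disjoint:
  fixes p :: "'i \<Rightarrow> 'b::countable pmf" and E :: "'j \<Rightarrow> ('i \<Rightarrow> 'b) set"
  assumes "finite A" "finite L" "L \<noteq> {}"
    and sub: "\<And>j. j \<in> L \<Longrightarrow> K j \<subseteq> A"
    and disj: "disjoint_family_on K L"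
    and dep: "\<And>j. j \<in> L \<Longrightarrow> depends_on (E j) (K j)"
  shows "measure_pmf.prob (Pi_pmf A dflt p) (\<Inter>j\<in>L. E j)
    = (\<Prod>j\<in>L. measure_pmf.prob (Pi_pmf A dflt p) (E j))"
proof -
  have ind: "prob_space.indep_vars (measure_pmf (Pi_pmf A dflt p)) (\<lambda>j. PiM (K j) (\<lambda>_. count_space UNIV))
      (\<lambda>j \<omega>. restrict (\<lambda>i. \<omega> i) (K j)) L"
    using sub disj by (intro prob_space.indep_vars_restrict[OF prob_space_measure_pmf indep_vars_Pi_pmf[OF \<open>finite A\<close>]]) auto
  \<comment> \<open>The block is finite and the values are countable, so the product sigma-algebra
    is discrete and measurability is automatic.\<close>
  have meas: "E j \<inter> PiE (K j) (\<lambda>_. UNIV) \<in> sets (PiM (K j) (\<lambda>_. count_space UNIV))" if "j \<in> L" for j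
  proof -
    have "finite (K j)" using sub[OF that] \<open>finite A\<close> finite_subset by blast
    then have "PiM (K j) (\<lambda>_. count_space (UNIV :: 'b set)) = count_space (PiE (K j) (\<lambda>_. UNIV))"
      by (intro count_space_PiM_finite) auto
    then show ?thesis by simp
  qed
  have eq: "(\<lambda>\<omega>. restrict (\<lambda>i. \<omega> i) (K j)) -` (E j \<inter> PiE (K j) (\<lambda>_. UNIV)) = E j" if "j \<in> L" for j
  proof -
    have "restrict \<omega> (K j) \<in> E j \<longleftrightarrow> \<omega> \<in> E j" for \<omega>
      using dep[OF that] unfolding depends_on_def by (metis restrict_apply')
    then show ?thesis by auto
  qed
  from prob_space.indep_varsD_finite[OF prob_space_measure_pmf ind \<open>L \<noteq> {}\<close> \<open>finite L\<close> meas] show ?thesis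
    using eq by simp
qed

lemma prob_Int_depends_on_disjoint:
  fixes p :: "'i \<Rightarrow> 'b::countable pmf"
  assumes "finite A" "X \<subseteq> A" "Y \<subseteq> A" "X \<inter> Y = {}" "depends_on E X" "depends_on F Y"
  shows "measure_pmf.prob (Pi_pmf A dflt p) (E \<inter> F)
    = measure_pmf.prob (Pi_pmf A dflt p) E * measure_pmf.prob (Pi_pmf A dflt p) F"
proof -
  have "measure_pmf.prob (Pi_pmf A dflt p) (\<Inter>b\<in>UNIV. if b then E else F)
    = (\<Prod>b\<in>UNIV. measure_pmf.prob (Pi_pmf A dflt p) (if b then E else F))"
    using assms
    by (intro prob_Inter_depends_on_disjoint[where K = "\<lambda>b. if b then X else Y"])
       (auto simp: disjoint_family_on_def)
  then show ?thesis by (simp add: UNIV_bool Int_commute mult.commute)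
qed


section \<open>Random selections of colors\<close>

lemma sum_card_fibres_le:
  assumes "finite N" "finite C"
  shows "(\<Sum>c\<in>C. card {w\<in>N. g w = c}) \<le> card N"
proof -
  have "(\<Sum>c\<in>C. card {w\<in>N. g w = c}) = card (\<Union>c\<in>C. {w\<in>N. g w = c})"
    using assms by (intro card_UN_disjoint[symmetric]) auto
  also have "\<dots> \<le> card N" using assms by (intro card_mono) auto
  finally show ?thesis .
qed

text \<open>Each factor is bounded using \<open>1 - t \<le> exp (- t)\<close> and Bernoulli's
  inequality. The value of \<open>p\<close> maximizes the resulting exponent
  \<open>p * (card C - p * d)\<close>, and \<open>card C \<le> 2 * d\<close> makes it a
  probability.\<close>

lemma prod_blocking_le:
  fixes n :: "'c \<Rightarrow> nat" and d :: nat and p :: real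
  assumes "finite C" "card C > 0" "card C \<le> 2 * d" "p = card C / (2 * d)"
    and "(\<Sum>c\<in>C. n c) \<le> d"
  shows "(\<Prod>c\<in>C. 1 - p * (1 - p) ^ n c) \<le> exp (- (real (card C))\<^sup>2 / (4 * d))"
proof -
  have d: "d > 0" using assms by auto
  have p: "0 \<le> p" "p \<le> 1" using assms d by auto
  have "(\<Prod>c\<in>C. 1 - p * (1 - p) ^ n c) \<le> (\<Prod>c\<in>C. exp (- (p * (1 - p * n c))))"
  proof (intro prod_mono conjI)
    fix c
    have "p * (1 - p) ^ n c \<le> 1" using p by (intro mult_le_one power_le_one) auto
    then show "0 \<le> 1 - p * (1 - p) ^ n c" by simp
    have "1 - p * n c \<le> (1 - p) ^ n c" using Bernoulli_inequality[of "-p" "n c"] p by (simp add: mult.commute)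
    then have "p * (1 - p * n c) \<le> p * (1 - p) ^ n c" using p by (intro mult_left_mono) auto
    then show "1 - p * (1 - p) ^ n c \<le> exp (- (p * (1 - p * n c)))"
      using exp_ge_add_one_self[of "- (p * (1 - p * n c))"] by linarith
  qed
  also have "\<dots> = exp (- (p * (card C - p * (\<Sum>c\<in>C. n c))))"
    using assms(1) by (simp flip: exp_sum add: sum_negf sum_distrib_left sum_subtractf algebra_simps)
  also have "\<dots> \<le> exp (- (p * (card C - p * d)))"
    using p assms(5) by (auto intro!: mult_left_mono simp del: of_nat_sum)
  also have "p * (card C - p * d) = (real (card C))\<^sup>2 / (4 * d)"
    using d by (simp add: assms(4) field_simps power2_eq_square)
  finally show ?thesis by simp
qed

text \<open>The event prescribes the values of \<open>1 + card N\<close> independent coordinates,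
  which are distinct because \<open>v \<notin> N\<close>.\<close>

lemma prob_color_available:
  assumes "finite V" "finite C" "v \<in> V" "c \<in> C" "N \<subseteq> V" "v \<notin> N"
    and "\<And>w. w \<in> N \<Longrightarrow> h w \<in> C" and p: "0 \<le> p" "p \<le> 1"
  shows "measure_pmf.prob (Pi_pmf (V \<times> C) False (\<lambda>_. bernoulli_pmf p))
      {\<omega>. \<omega> (v, c) \<and> (\<forall>w\<in>N. \<not> \<omega> (w, h w))} = p * (1 - p) ^ card N"
proof -
  have finN: "finite N" using assms finite_subset by blast
  define Y where "Y = (\<lambda>w. (w, h w)) ` N"
  have Y: "Y \<subseteq> V \<times> C" "(v, c) \<notin> Y" "finite Y" "card Y = card N"
    using assms finN by (auto simp: Y_def intro!: card_image inj_onI)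
  \<comment> \<open>The event as a box: unconstrained coordinates get \<open>UNIV\<close> and
    contribute the factor 1.\<close>
  define B where "B = (\<lambda>x. if x = (v, c) then {True} else if x \<in> Y then {False} else UNIV)"
  have "{\<omega>. \<omega> (v, c) \<and> (\<forall>w\<in>N. \<not> \<omega> (w, h w))} = Pi (V \<times> C) B"
  proof (intro set_eqI iffI)
    fix \<omega> assume "\<omega> \<in> {\<omega>. \<omega> (v, c) \<and> (\<forall>w\<in>N. \<not> \<omega> (w, h w))}"
    then have "\<omega> (v, c)" "\<And>x. x \<in> Y \<Longrightarrow> \<not> \<omega> x" by (auto simp: Y_def)
    then show "\<omega> \<in> Pi (V \<times> C) B" by (simp add: B_def Pi_def)
  next
    fix \<omega> assume \<omega>: "\<omega> \<in> Pi (V \<times> C) B"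
    have *: "\<omega> x \<in> B x" if "x \<in> insert (v, c) Y" for x
      using Pi_mem[OF \<omega>] that Y(1) assms(3,4) by blast
    have "\<omega> (v, c)" using *[of "(v, c)"] by (simp add: B_def)
    moreover have "\<not> \<omega> x" if "x \<in> Y" for x
      using *[of x] that Y(2) by (auto simp: B_def split: if_splits)
    ultimately show "\<omega> \<in> {\<omega>. \<omega> (v, c) \<and> (\<forall>w\<in>N. \<not> \<omega> (w, h w))}" by (auto simp: Y_def)
  qed
  then have "measure_pmf.prob (Pi_pmf (V \<times> C) False (\<lambda>_. bernoulli_pmf p))
      {\<omega>. \<omega> (v, c) \<and> (\<forall>w\<in>N. \<not> \<omega> (w, h w))} = (\<Prod>x\<in>V \<times> C. measure_pmf.prob (bernoulli_pmf p) (B x))"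
    using assms by (simp add: measure_Pi_pmf_Pi)
  also have "\<dots> = (\<Prod>x\<in>insert (v, c) Y. measure_pmf.prob (bernoulli_pmf p) (B x))"
    using assms Y by (intro prod.mono_neutral_right) (auto simp: B_def)
  also have "\<dots> = p * (\<Prod>x\<in>Y. measure_pmf.prob (bernoulli_pmf p) (B x))"
    using Y p by (simp add: B_def measure_pmf_single)
  also have "(\<Prod>x\<in>Y. measure_pmf.prob (bernoulli_pmf p) (B x)) = (\<Prod>x\<in>Y. 1 - p)"
    using Y p by (intro prod.cong) (auto simp: B_def measure_pmf_single)
  finally show ?thesis using Y by simp
qed

lemma card_conflicting_closed_nbhds_le:
  fixes N :: "'a \<Rightarrow> 'a set" and d \<Delta> :: nat
  assumes "finite V"
    and N: "\<And>u. u \<in> V \<Longrightarrow> N u \<subseteq> V"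
    and d: "card (N v) \<le> d" "1 \<le> d"
    and \<Delta>: "\<And>u. u \<in> V \<Longrightarrow> card (N u) + card {w\<in>V. u \<in> N w} \<le> \<Delta>" "1 \<le> \<Delta>"
    and v: "v \<in> V"
  shows "card {u\<in>V. insert v (N v) \<inter> insert u (N u) \<noteq> {}} \<le> (d + 1) * \<Delta>"
proof -
  define M where "M u = {w\<in>V. u \<in> N w}" for u
  have finM: "finite (M u)" for u using assms(1) by (simp add: M_def)
  have finN: "finite (N u)" if "u \<in> V" for u using N[OF that] assms(1) finite_subset by blast
  \<comment> \<open>Besides \<open>v\<close> itself, such a \<open>u\<close> is an in-neighbour of
    \<open>v\<close>, or an out-neighbour \<open>x\<close> of \<open>v\<close>, or another
    in-neighbour of such an \<open>x\<close>.\<close>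
  have "{u\<in>V. insert v (N v) \<inter> insert u (N u) \<noteq> {}} \<subseteq>
      insert v (M v \<union> (\<Union>x\<in>N v. insert x (M x) - {v}))" (is "_ \<subseteq> ?R")
    by (auto simp: M_def)
  then have "card {u\<in>V. insert v (N v) \<inter> insert u (N u) \<noteq> {}} \<le> card ?R"
    using finM finN[OF v] by (intro card_mono) auto
  also have "\<dots> \<le> Suc (card (M v \<union> (\<Union>x\<in>N v. insert x (M x) - {v})))"
    by (rule card_insert_le_m1) auto
  also have "\<dots> \<le> Suc (card (M v) + card (\<Union>x\<in>N v. insert x (M x) - {v}))"
    using card_Un_le by auto
  also have "card (\<Union>x\<in>N v. insert x (M x) - {v}) \<le> (\<Sum>x\<in>N v. card (insert x (M x) - {v}))"
    using finN[OF v] by (rule card_UN_le)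
  also have "\<dots> \<le> (\<Sum>x\<in>N v. \<Delta>)"
  proof (rule sum_mono)
    fix x assume x: "x \<in> N v"
    \<comment> \<open>Removing \<open>v\<close>, itself an in-neighbour of \<open>x\<close>, makes
      up for adding \<open>x\<close>.\<close>
    have "v \<in> insert x (M x)" using x v by (auto simp: M_def)
    then have "card (insert x (M x) - {v}) = card (insert x (M x)) - 1" by simp
    also have "\<dots> \<le> card (M x)" using finM[of x] by (simp add: card_insert_if)
    also have "\<dots> \<le> \<Delta>" using \<Delta>(1)[of x] x N[OF v] by (auto simp: M_def)
    finally show "card (insert x (M x) - {v}) \<le> \<Delta>" .
  qed
  finally have "card {u\<in>V. insert v (N v) \<inter> insert u (N u) \<noteq> {}} \<le> Suc (card (M v) + card (N v) * \<Delta>)"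
    by simp
  also have "\<dots> \<le> (d + 1) * \<Delta>"
  \<comment> \<open>The extra 1 for \<open>v\<close> must be absorbed: by
    \<open>d * \<Delta> \<ge> 1\<close> if \<open>v\<close> has no out-neighbours, and otherwise by
    \<open>card (M v) < \<Delta>\<close>.\<close>
  proof (cases "card (N v)")
    case 0
    have "1 \<le> d * \<Delta>" using mult_le_mono[OF d(2) \<Delta>(2)] by simp
    moreover have "card (M v) \<le> \<Delta>" using \<Delta>(1)[OF v] by (simp add: M_def)
    ultimately show ?thesis by (simp only: 0 add_mult_distrib mult_0 mult_1)
  next
    case (Suc n)
    have "card (N v) * \<Delta> \<le> d * \<Delta>" using d by (intro mult_le_mono1)
    then show ?thesis using \<Delta>(1)[OF v] Suc by (simp add: M_def)
  qed
  finally show ?thesis .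
qed

lemma exists_color_selection:
  fixes N :: "'a \<Rightarrow> 'a set" and f :: "'a \<Rightarrow> 'a \<Rightarrow> 'c \<times> 'c" and d \<Delta> :: nat
  assumes "finite V" "finite C"
    and N: "\<And>v. v \<in> V \<Longrightarrow> N v \<subseteq> V" "\<And>v. v \<in> V \<Longrightarrow> v \<notin> N v"
    and d: "\<And>v. v \<in> V \<Longrightarrow> card (N v) \<le> d" "1 \<le> d"
    and \<Delta>: "\<And>v. v \<in> V \<Longrightarrow> card (N v) + card {u\<in>V. v \<in> N u} \<le> \<Delta>" "1 \<le> \<Delta>"
    and f: "\<And>v w. v \<in> V \<Longrightarrow> w \<in> N v \<Longrightarrow> f v w \<in> C \<times> C"
    and C: "4 * d * (1 + ln (real ((d + 1) * \<Delta>))) \<le> (real (card C))\<^sup>2"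
  shows "\<exists>S. \<forall>v\<in>V. \<exists>c\<in>C \<inter> S v. \<forall>w\<in>N v. fst (f v w) = c \<longrightarrow> snd (f v w) \<notin> S w"
proof (cases "card C \<le> 2 * d")
  case False
  \<comment> \<open>Pigeonhole: the at most \<open>d\<close> conflicts of \<open>v\<close> with its
    out-neighbours cannot involve all colors at \<open>v\<close>.\<close>
  have "\<exists>c\<in>C. c \<notin> (\<lambda>w. fst (f v w)) ` N v" if v: "v \<in> V" for v
  proof (rule ccontr)
    have fin: "finite (N v)" using N(1)[OF v] \<open>finite V\<close> finite_subset by blast
    assume "\<not> ?thesis"
    then have "card C \<le> card ((\<lambda>w. fst (f v w)) ` N v)" using fin by (intro card_mono) auto
    also have "\<dots> \<le> card (N v)" using fin by (rule card_image_le)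
    finally show False using d(1)[OF v] False by simp
  qed
  then have "\<forall>v\<in>V. \<exists>c\<in>C. \<forall>w\<in>N v. fst (f v w) \<noteq> c" by (metis imageI)
  then show ?thesis by (intro exI[of _ "\<lambda>_. C"]) (metis Int_absorb)
next
  case True
  define K where "K = (d + 1) * \<Delta>"
  have K: "2 \<le> K" using mult_le_mono[of 2 "d + 1" 1 \<Delta>] d \<Delta> by (simp add: K_def)
  have Cpos: "card C > 0"
  proof (rule ccontr)
    assume "\<not> ?thesis"
    then have "4 * d * (1 + ln (real K)) \<le> 0" using C by (simp add: K_def)
    moreover have "0 < 4 * d * (1 + ln (real K))" using d(2) K by (intro mult_pos_pos add_pos_nonneg ln_ge_zero) auto
    ultimately show False by linarith
  qed
  define p :: real where "p = card C / (2 * d)"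
  have p: "0 \<le> p" "p \<le> 1" using True d by (auto simp: p_def)
  define P where "P = Pi_pmf (V \<times> C) False (\<lambda>_. bernoulli_pmf p)"
  define avail where "avail v c =
    {\<omega> :: 'a \<times> 'c \<Rightarrow> bool. \<omega> (v, c) \<and> (\<forall>w\<in>{w\<in>N v. fst (f v w) = c}. \<not> \<omega> (w, snd (f v w)))}" for v c
  define A where "A v = (\<Inter>c\<in>C. - avail v c)" for v
  define nb where "nb v = insert v (N v)" for v
  define \<Gamma> where "\<Gamma> v = {u\<in>V. nb v \<inter> nb u \<noteq> {}}" for v
  \<comment> \<open>The coordinates that decide availability of \<open>c\<close> at
    \<open>v\<close>.\<close>
  define X where "X v c = insert (v, c) ((\<lambda>w. (w, snd (f v w))) ` {w\<in>N v. fst (f v w) = c})" for v c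
  have dep_avail: "depends_on (- avail v c) (X v c)" for v c
    by (auto simp: depends_on_def avail_def X_def)
  have X: "X v c \<subseteq> nb v \<times> C" if "v \<in> V" "c \<in> C" for v c
    using f[OF that(1)] that by (fastforce simp: X_def nb_def mem_Times_iff)
  have nb: "nb v \<subseteq> V" if "v \<in> V" for v using N(1) that by (auto simp: nb_def)
  have dep_A: "depends_on (A v) (nb v \<times> C)" if "v \<in> V" for v
    unfolding depends_on_def
  proof (intro allI impI)
    fix \<omega> \<omega>' :: "'a \<times> 'c \<Rightarrow> bool" assume eq: "\<forall>x\<in>nb v \<times> C. \<omega> x = \<omega>' x"
    have "\<omega> \<in> - avail v c \<longleftrightarrow> \<omega>' \<in> - avail v c" if "c \<in> C" for c
    proof -
      have "\<forall>x\<in>X v c. \<omega> x = \<omega>' x" using eq X[OF \<open>v \<in> V\<close> that] by blast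
      then show ?thesis using dep_avail[of v c] unfolding depends_on_def by metis
    qed
    then show "\<omega> \<in> A v \<longleftrightarrow> \<omega>' \<in> A v" by (auto simp: A_def)
  qed
  have prob_A: "measure_pmf.prob P (A v) \<le> exp (- (real (card C))\<^sup>2 / (4 * d))" if v: "v \<in> V" for v
  proof -
    \<comment> \<open>Each out-neighbour \<open>w\<close> contributes a coordinate only to the block
      of the color \<open>fst (f v w)\<close>, and \<open>v \<notin> N v\<close> keeps it apart from
      the coordinates of \<open>v\<close>. Hence the availabilities of the different colors at
      \<open>v\<close> are independent.\<close>
    have "disjoint_family_on (X v) C"
      using N(2)[OF v] by (auto simp: disjoint_family_on_def X_def)
    moreover have "X v c \<subseteq> V \<times> C" if "c \<in> C" for c using X[OF v that] nb[OF v] by blast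
    ultimately have "measure_pmf.prob P (A v) = (\<Prod>c\<in>C. measure_pmf.prob P (- avail v c))"
      unfolding A_def P_def using \<open>finite V\<close> \<open>finite C\<close> Cpos dep_avail
      by (intro prob_Inter_depends_on_disjoint[where K = "X v"]) auto
    also have "\<dots> = (\<Prod>c\<in>C. 1 - p * (1 - p) ^ card {w\<in>N v. fst (f v w) = c})"
    proof (rule prod.cong)
      fix c assume c: "c \<in> C"
      have "measure_pmf.prob P (avail v c) = p * (1 - p) ^ card {w\<in>N v. fst (f v w) = c}"
        unfolding P_def avail_def
        using \<open>finite V\<close> \<open>finite C\<close> v c p N[OF v] f[OF v]
        by (intro prob_color_available) (auto simp: mem_Times_iff)
      then show "measure_pmf.prob P (- avail v c) = 1 - p * (1 - p) ^ card {w\<in>N v. fst (f v w) = c}"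
        using measure_pmf.prob_compl[of "avail v c" P] by (simp add: Compl_eq_Diff_UNIV)
    qed simp
    also have "\<dots> \<le> exp (- (real (card C))\<^sup>2 / (4 * d))"
    proof (rule prod_blocking_le)
      have "finite (N v)" using N(1)[OF v] \<open>finite V\<close> finite_subset by blast
      then show "(\<Sum>c\<in>C. card {w\<in>N v. fst (f v w) = c}) \<le> d"
        using sum_card_fibres_le[of "N v" C "\<lambda>w. fst (f v w)"] d(1)[OF v] \<open>finite C\<close> by linarith
    qed (use True Cpos \<open>finite C\<close> p_def in auto)
    finally show ?thesis .
  qed
  have "\<exists>\<omega>\<in>space (measure_pmf P). \<forall>v\<in>V. \<omega> \<notin> A v"
  proof (rule measure_pmf.symmetric_local_lemma[where K = K and \<Gamma> = \<Gamma>])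
    fix v assume v: "v \<in> V"
    show "v \<in> \<Gamma> v" "finite (\<Gamma> v)" using v \<open>finite V\<close> by (auto simp: \<Gamma>_def nb_def)
    show "card (\<Gamma> v) \<le> K"
      unfolding \<Gamma>_def nb_def K_def using assms v
      by (intro card_conflicting_closed_nbhds_le) auto
    \<comment> \<open>Here the assumed number of colors enters: it makes the bound equal to
      \<open>1 / (exp 1 * K)\<close>, just what the Local Lemma asks for.\<close>
    have "measure_pmf.prob P (A v) \<le> exp (- (1 + ln (real K)))"
    proof -
      have "1 + ln (real K) \<le> (real (card C))\<^sup>2 / (4 * d)"
        using C d by (simp add: K_def field_simps)
      then show ?thesis using prob_A[OF v] by (smt (verit) exp_le_cancel_iff minus_divide_left)
    qed
    also have "\<dots> = 1 / (exp 1 * real K)"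
      using K by (simp only: exp_minus exp_add exp_ln) (simp add: field_simps)
    finally show "exp 1 * measure_pmf.prob P (A v) * real K \<le> 1"
      using K by (simp add: field_simps)
  next
    fix v J assume v: "v \<in> V" and J: "J \<subseteq> V - \<Gamma> v"
    \<comment> \<open>Avoiding all \<open>A u\<close> with \<open>u \<in> J\<close> is decided in
      closed out-neighbourhoods disjoint from that of \<open>v\<close>, as no such \<open>u\<close>
      lies in \<open>\<Gamma> v\<close>.\<close>
    have "depends_on (UNIV - (\<Union>u\<in>J. A u)) ((\<Union>u\<in>J. nb u) \<times> C)"
      unfolding depends_on_def
    proof (intro allI impI)
      fix \<omega> \<omega>' :: "'a \<times> 'c \<Rightarrow> bool" assume eq: "\<forall>x\<in>(\<Union>u\<in>J. nb u) \<times> C. \<omega> x = \<omega>' x"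
      have "\<omega> \<in> A u \<longleftrightarrow> \<omega>' \<in> A u" if "u \<in> J" for u
      proof -
        have "\<forall>x\<in>nb u \<times> C. \<omega> x = \<omega>' x" using eq that by blast
        then show ?thesis using dep_A[of u] J that unfolding depends_on_def by (metis Diff_iff subsetD)
      qed
      then show "\<omega> \<in> UNIV - (\<Union>u\<in>J. A u) \<longleftrightarrow> \<omega>' \<in> UNIV - (\<Union>u\<in>J. A u)" by auto
    qed
    moreover have "nb v \<times> C \<inter> (\<Union>u\<in>J. nb u) \<times> C = {}"
      using J by (auto simp: \<Gamma>_def)
    moreover have "(\<Union>u\<in>J. nb u) \<times> C \<subseteq> V \<times> C" "nb v \<times> C \<subseteq> V \<times> C" using nb J v by blast+
    ultimately show "measure_pmf.prob P (A v \<inter> (space (measure_pmf P) - (\<Union>u\<in>J. A u))) =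
        measure_pmf.prob P (A v) * measure_pmf.prob P (space (measure_pmf P) - (\<Union>u\<in>J. A u))"
      unfolding P_def using \<open>finite V\<close> \<open>finite C\<close> dep_A[OF v]
      by (simp add: prob_Int_depends_on_disjoint[where X = "nb v \<times> C" and Y = "(\<Union>u\<in>J. nb u) \<times> C"])
  qed (use \<open>finite V\<close> K in auto)
  then obtain \<omega> where \<omega>: "\<And>v. v \<in> V \<Longrightarrow> \<omega> \<notin> A v" by auto
  show ?thesis
  proof (intro exI[of _ "\<lambda>v. {c. \<omega> (v, c)}"] ballI)
    fix v assume "v \<in> V"
    from \<omega>[OF this] obtain c where "c \<in> C" "\<omega> \<in> avail v c" by (auto simp: A_def)
    then show "\<exists>c\<in>C \<inter> {c. \<omega> (v, c)}. \<forall>w\<in>N v. fst (f v w) = c \<longrightarrow> snd (f v w) \<notin> {c. \<omega> (w, c)}"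
      by (intro bexI[of _ c]) (auto simp: avail_def)
  qed
qed

section \<open>Orienting a degenerate graph\<close>

lemma (in fin_digraph) card_dominated_le_out_degree:
  "card {w. v \<rightarrow>\<^bsub>G\<^esub> w} \<le> out_degree G v"
proof -
  have "{w. v \<rightarrow>\<^bsub>G\<^esub> w} = head G ` out_arcs G v"
    by (auto simp: arcs_ends_conv out_arcs_def)
  then show ?thesis unfolding out_degree_def by (simp add: card_image_le finite_out_arcs)
qed

text \<open>A vertex of degree at most \<open>d\<close> in the subgraph induced by \<open>U\<close>
  is ranked last, and the rest is ranked recursively. The bound \<open>r v < card U\<close> leaves a
  fresh top rank for the next vertex.\<close>

lemma (in pseudo_graph) degenerate_ranking:
  assumes deg: "degenerate d G" and "U \<subseteq> verts G"
  shows "\<exists>r :: 'a \<Rightarrow> nat. inj_on r U \<and> (\<forall>v\<in>U. r v < card U) \<and>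
    (\<forall>v\<in>U. card {w\<in>U. v \<rightarrow>\<^bsub>G\<^esub> w \<and> r w < r v} \<le> d)"
proof -
  have "finite U" using assms(2) finite_verts by (rule finite_subset)
  then show ?thesis using \<open>U \<subseteq> verts G\<close>
  proof (induction "card U" arbitrary: U)
    case 0
    then show ?case by simp
  next
    case (Suc n)
    let ?H = "G \<restriction> U"
    have adj: "v \<rightarrow>\<^bsub>?H\<^esub> w \<longleftrightarrow> v \<in> U \<and> w \<in> U \<and> v \<rightarrow>\<^bsub>G\<^esub> w" for v w
      by (auto simp: arcs_ends_conv)
    have "wf_digraph ?H" by (rule wellformed_induce_subgraph)
    moreover have "finite (arcs ?H)" "finite (verts ?H)" using Suc by auto
    ultimately have fd: "fin_digraph ?H" by (simp add: fin_digraph_def fin_digraph_axioms_def)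
    have "subgraph ?H G"
      using Suc.prems \<open>wf_digraph ?H\<close> compatible_induce_subgraph[of G U] wf_digraph
      by (auto simp: subgraph_def compatible_def)
    moreover have "symmetric ?H"
      unfolding symmetric_def by (rule symI) (auto simp: adj intro: graph_symmetric)
    moreover have "U \<noteq> {}" using Suc by auto
    ultimately obtain v where v: "v \<in> U" "out_degree ?H v \<le> d"
      using deg unfolding degenerate_def by (metis induce_subgraph_verts)
    then have vd: "card {w\<in>U. v \<rightarrow>\<^bsub>G\<^esub> w} \<le> d"
      using fin_digraph.card_dominated_le_out_degree[OF fd, of v] by (simp add: adj)
    have card: "card (U - {v}) = n" using v Suc by simp
    then have "\<exists>r :: 'a \<Rightarrow> nat. inj_on r (U - {v}) \<and> (\<forall>u\<in>U - {v}. r u < n) \<and>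
      (\<forall>u\<in>U - {v}. card {w\<in>U - {v}. u \<rightarrow>\<^bsub>G\<^esub> w \<and> r w < r u} \<le> d)"
      using Suc.hyps(1)[OF card[symmetric]] Suc.prems unfolding card by fast
    then obtain r :: "'a \<Rightarrow> nat" where r: "inj_on r (U - {v})" "\<forall>u\<in>U - {v}. r u < n"
      "\<forall>u\<in>U - {v}. card {w\<in>U - {v}. u \<rightarrow>\<^bsub>G\<^esub> w \<and> r w < r u} \<le> d"
      by blast
    \<comment> \<open>Since \<open>v\<close> gets the largest rank, the lower-ranked neighbours of
      all other vertices stay the same.\<close>
    define r' where "r' = r(v := n)"
    have r': "r' v = n" "\<And>u. u \<noteq> v \<Longrightarrow> r' u = r u" by (auto simp: r'_def)
    have "inj_on r' U"
    proof (rule inj_onI)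
      fix a b assume ab: "a \<in> U" "b \<in> U" "r' a = r' b"
      show "a = b"
      proof (cases "a = v \<or> b = v")
        case True
        then show ?thesis using ab r(2) by (auto simp: r'_def split: if_splits)
      next
        case False
        then show ?thesis using ab r' r(1) by (auto dest: inj_onD)
      qed
    qed
    moreover have "\<forall>u\<in>U. r' u < card U"
      using r(2) Suc.hyps(2)[symmetric] by (auto simp: r'_def less_SucI)
    moreover have "card {w\<in>U. u \<rightarrow>\<^bsub>G\<^esub> w \<and> r' w < r' u} \<le> d" if u: "u \<in> U" for u
    proof (cases "u = v")
      case True
      have "card {w\<in>U. u \<rightarrow>\<^bsub>G\<^esub> w \<and> r' w < r' u} \<le> card {w\<in>U. v \<rightarrow>\<^bsub>G\<^esub> w}"
        using True Suc.prems by (intro card_mono) auto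
      then show ?thesis using vd by simp
    next
      case False
      then have "r u < n" using r(2) u by blast
      with False have "{w\<in>U. u \<rightarrow>\<^bsub>G\<^esub> w \<and> r' w < r' u} = {w\<in>U - {v}. u \<rightarrow>\<^bsub>G\<^esub> w \<and> r w < r u}"
        by (auto simp: r'_def split: if_splits)
      then show ?thesis using r(3) u False by auto
    qed
    ultimately show ?case by blast
  qed
qed

lemma (in fin_digraph) out_degree_le_max_degree:
  "v \<in> verts G \<Longrightarrow> out_degree G v \<le> max_degree G"
  unfolding max_degree_def by (intro Max_ge) auto

text \<open>Edges are directed towards the smaller rank; injectivity of the ranking makes sure that
  every edge gets a direction.\<close>

lemma (in graph) degenerate_orientation:
  assumes "degenerate d G"
  obtains N where "\<And>v. N v \<subseteq> {w. v \<rightarrow>\<^bsub>G\<^esub> w}"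
    and "\<And>v w. v \<rightarrow>\<^bsub>G\<^esub> w \<Longrightarrow> w \<in> N v \<or> v \<in> N w"
    and "\<And>v. v \<in> verts G \<Longrightarrow> card (N v) \<le> d"
    and "\<And>v. v \<in> verts G \<Longrightarrow> card (N v) + card {u\<in>verts G. v \<in> N u} \<le> max_degree G"
proof -
  obtain r :: "'a \<Rightarrow> nat" where r: "inj_on r (verts G)"
    "\<forall>v\<in>verts G. card {w\<in>verts G. v \<rightarrow>\<^bsub>G\<^esub> w \<and> r w < r v} \<le> d"
    using degenerate_ranking[OF assms order_refl] by blast
  define N where "N v = {w\<in>verts G. v \<rightarrow>\<^bsub>G\<^esub> w \<and> r w < r v}" for v
  show thesis
  proof (rule that)
    show "N v \<subseteq> {w. v \<rightarrow>\<^bsub>G\<^esub> w}" for v by (auto simp: N_def)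
    show "card (N v) \<le> d" if "v \<in> verts G" for v using r(2) that by (auto simp: N_def)
    fix v w assume vw: "v \<rightarrow>\<^bsub>G\<^esub> w"
    then have "v \<in> verts G" "w \<in> verts G" "v \<noteq> w"
      using no_loops by (auto simp: arcs_ends_conv)
    moreover from this have "r v \<noteq> r w" using r(1) by (auto dest: inj_onD)
    ultimately show "w \<in> N v \<or> v \<in> N w"
      using vw graph_symmetric[OF vw] by (auto simp: N_def)
  next
    fix v assume v: "v \<in> verts G"
    let ?M = "{u\<in>verts G. v \<in> N u}"
    have fin: "finite (N v)" "finite ?M" by (auto simp: N_def)
    \<comment> \<open>No vertex ranks both below and above \<open>v\<close>, so out- and
      in-neighbours are disjoint sets of neighbours.\<close>
    have "card (N v) + card ?M = card (N v \<union> ?M)"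
      using fin by (intro card_Un_disjoint[symmetric]) (auto simp: N_def)
    also have "\<dots> \<le> card {w. v \<rightarrow>\<^bsub>G\<^esub> w}"
    proof (rule card_mono)
      have "{w. v \<rightarrow>\<^bsub>G\<^esub> w} \<subseteq> verts G" by (auto simp: arcs_ends_conv)
      then show "finite {w. v \<rightarrow>\<^bsub>G\<^esub> w}" using finite_verts by (rule finite_subset)
    qed (auto simp: N_def intro: graph_symmetric)
    also have "\<dots> \<le> max_degree G"
      using card_dominated_le_out_degree out_degree_le_max_degree[OF v] order_trans by blast
    finally show "card (N v) + card ?M \<le> max_degree G" .
  qed
qed

section \<open>From color selections to the bound on the single-conflict chromatic number\<close>

theorem theorem1p7:
  fixes G :: "('a, 'b) pre_digraph" and d :: nat
  assumes "graph G"
    and "degenerate d G"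
    and "max_degree G \<ge> 1"
  shows "int (chi_con G) \<le>
    \<lceil>2 * sqrt (real d * (1 + ln (real ((d + 1) * max_degree G))))\<rceil>"
proof -
  interpret graph G by fact
  obtain N where N: "\<And>v. N v \<subseteq> {w. v \<rightarrow>\<^bsub>G\<^esub> w}"
    "\<And>v w. v \<rightarrow>\<^bsub>G\<^esub> w \<Longrightarrow> w \<in> N v \<or> v \<in> N w"
    "\<And>v. v \<in> verts G \<Longrightarrow> card (N v) \<le> d"
    "\<And>v. v \<in> verts G \<Longrightarrow> card (N v) + card {u\<in>verts G. v \<in> N u} \<le> max_degree G"
    using degenerate_orientation[OF assms(2)] by blast
  have adj_verts: "v \<in> verts G \<and> w \<in> verts G \<and> v \<noteq> w" if "v \<rightarrow>\<^bsub>G\<^esub> w" for v w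
    using that no_loops by (auto simp: arcs_ends_conv)
  have N_verts: "N v \<subseteq> verts G" "v \<notin> N v" for v
    using N(1)[of v] adj_verts by blast+
  \<comment> \<open>Since \<open>max_degree G \<ge> 1\<close>, there is an edge, and one of its ends
    has an out-neighbour. For an edgeless graph and \<open>d = 0\<close> the bound would be 0,
    whereas \<open>chi_con\<close> is always counted with at least one color.\<close>
  have d: "1 \<le> d"
  proof -
    have "\<exists>v\<in>verts G. out_degree G v \<noteq> 0"
    proof (rule ccontr)
      assume "\<not> ?thesis"
      then have "insert 0 (out_degree G ` verts G) = {0}" by auto
      then show False using assms(3) by (simp only: max_degree_def) simp
    qed
    then obtain v where "out_arcs G v \<noteq> {}" unfolding out_degree_def by (metis card.empty)
    then obtain w where vw: "v \<rightarrow>\<^bsub>G\<^esub> w" by (auto simp: out_arcs_def arcs_ends_conv)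
    have "1 \<le> card (N u)" if "N u \<noteq> {}" for u
      using that N_verts(1)[of u] finite_verts finite_subset by (metis card_gt_0_iff One_nat_def Suc_leI)
    then show ?thesis using N(2)[OF vw] N(3)[of v] N(3)[of w] adj_verts[OF vw]
      by (metis emptyE order_trans)
  qed
  let ?x = "real d * (1 + ln (real ((d + 1) * max_degree G)))"
  define k where "k = nat \<lceil>2 * sqrt ?x\<rceil>"
  have "1 \<le> real ((d + 1) * max_degree G)"
    using assms(3) mult_le_mono[of 1 "d + 1" 1 "max_degree G"] by linarith
  then have x: "0 < ?x" using d by (intro mult_pos_pos add_pos_nonneg ln_ge_zero) auto
  then have "0 < k" by (simp add: k_def)
  have "2 * sqrt ?x \<le> real k" unfolding k_def by linarith
  then have "(2 * sqrt ?x)\<^sup>2 \<le> (real k)\<^sup>2" using x by (intro power_mono) auto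
  then have k: "4 * d * (1 + ln (real ((d + 1) * max_degree G))) \<le> (real k)\<^sup>2"
    using x by (simp add: power_mult_distrib mult.assoc)
  have "\<exists>\<phi>. single_conflict_coloring G C f \<phi>"
    if C: "finite C" "card C = k" "conflict_function G C f" for C :: "nat set" and f
  proof -
    have f: "f v w \<in> C \<times> C" "f w v = prod.swap (f v w)" if "v \<rightarrow>\<^bsub>G\<^esub> w" for v w
      using C(3) that graph_symmetric[OF that] unfolding conflict_function_def by blast+
    have "\<exists>S. \<forall>v\<in>verts G. \<exists>c\<in>C \<inter> S v. \<forall>w\<in>N v. fst (f v w) = c \<longrightarrow> snd (f v w) \<notin> S w"
    proof (rule exists_color_selection[where d = d and \<Delta> = "max_degree G"])
      show "4 * d * (1 + ln (real ((d + 1) * max_degree G))) \<le> (real (card C))\<^sup>2"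
        using k C(2) by simp
      fix v w assume "w \<in> N v"
      then have "v \<rightarrow>\<^bsub>G\<^esub> w" using N(1)[of v] by blast
      then show "f v w \<in> C \<times> C" by (rule f(1))
    qed (use C(1) N N_verts d assms(3) in auto)
    then obtain S \<phi> where \<phi>: "\<And>v. v \<in> verts G \<Longrightarrow> \<phi> v \<in> C \<and> \<phi> v \<in> S v"
      "\<And>v w. v \<in> verts G \<Longrightarrow> w \<in> N v \<Longrightarrow> fst (f v w) = \<phi> v \<Longrightarrow> snd (f v w) \<notin> S w"
      by (metis IntD1 IntD2)
    \<comment> \<open>The color of \<open>w\<close> lies in \<open>S w\<close>, but the color at
      \<open>w\<close> that conflicts with an available color of \<open>v\<close> does not.\<close>
    have oriented: "(\<phi> v, \<phi> w) \<noteq> f v w" if "w \<in> N v" "v \<in> verts G" "w \<in> verts G" for v w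
      using \<phi>(1)[of w] \<phi>(2)[of v w] that by (metis fst_conv snd_conv)
    \<comment> \<open>An edge directed from \<open>w\<close> to \<open>v\<close> is treated from the
      side of \<open>w\<close>, using the symmetry of \<open>f\<close> under swapping.\<close>
    have "(\<phi> v, \<phi> w) \<noteq> f v w" if vw: "v \<rightarrow>\<^bsub>G\<^esub> w" for v w
      using N(2)[OF vw]
    proof
      assume "v \<in> N w"
      then have "(\<phi> w, \<phi> v) \<noteq> f w v" using oriented adj_verts[OF vw] by blast
      then show ?thesis using f(2)[OF vw] by (metis swap_simp)
    qed (use oriented adj_verts[OF vw] in blast)
    then show ?thesis using \<phi>(1) unfolding single_conflict_coloring_def by blast
  qed
  then have "chi_con G \<le> k"
    unfolding chi_con_def using \<open>0 < k\<close> by (intro Least_le) blast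
  then show ?thesis using \<open>0 < k\<close> unfolding k_def by linarith
qed

end
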